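(* Let $\alpha_1,\alpha_2\in\mathbb{R}\setminus\mathbb{Q}$ and let $I_1,I_2\subset S^1$ be finite unions of closed intervals with nonempty interiors, each different from $\emptyset$ and from $S^1$, and each having no rotational symmetries. Then the itinerary of $0$ under $r_{\alpha_1}$ relative to $I_1$ and the itinerary of $0$ under $r_{\alpha_2}$ relative to $I_2$ are the same if and only if either ($\{\alpha_1\}=\{\alpha_2\}$ and $I_1=I_2$) or ($\{\alpha_1\}=1-\{\alpha_2\}$ and $I_1=-I_2$).
   Context: $S^1=\mathbb{R}/\mathbb{Z}$. For $\alpha\in\mathbb{R}$, $r_\alpha:S^1\to S^1$ is the rotation $r_\alpha(z)=z+\alpha \bmod 1$. A closed interval in $S^1$ is a closed arc. For $I\subset S^1$, the itinerary of $0$ under $r_\alpha$ relative to $I$ is the sequence $(a_0,a_1,a_2,\ldots)$ with $a_i=1$ if $r_\alpha^i(0)\in I$ and $a_i=0$ otherwise. $\{y\}=y-\lfloor y\rfloor$ denotes the fractional part of $y$, and $-I=\{-z:z\in I\}$. For a positive integer $n$, $I$ has $n$-fold rotational symmetry if $I+1/n=I$ in $\mathbb{R}/\mathbb{Z}$; $I$ has no rotational symmetries if it does not have $n$-fold rotational symmetry for any integer $n\ge 2$. *)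

theory Defs
  imports "HOL-Analysis.Analysis"
begin

quotient_type circle = real / "\<lambda>x y :: real. x - y \<in> \<int>"
  morphisms rep_circle circle_of
proof (rule equivpI)
  show "reflp (\<lambda>x y :: real. x - y \<in> \<int>)"
    by (simp add: reflp_def)
  show "symp (\<lambda>x y :: real. x - y \<in> \<int>)"
    by (rule sympI) (drule Ints_minus, simp)
  show "transp (\<lambda>x y :: real. x - y \<in> \<int>)"
    by (rule transpI) (drule (1) Ints_add, simp)
qed

instantiation circle :: ab_group_add
begin

lift_definition zero_circle :: circle is "0 :: real" .

lift_definition plus_circle :: "circle \<Rightarrow> circle \<Rightarrow> circle" is "(+)"
  by (drule (1) Ints_add, simp add: algebra_simps)

lift_definition uminus_circle :: "circle \<Rightarrow> circle" is "uminus"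
  by (drule Ints_minus, simp)

lift_definition minus_circle :: "circle \<Rightarrow> circle \<Rightarrow> circle" is "(-)"
  by (drule (1) Ints_diff, simp add: algebra_simps)

instance
  by standard (transfer; simp add: algebra_simps)+

end

text \<open>The quotient topology of the projection from the real line.\<close>

instantiation circle :: topological_space
begin

definition open_circle :: "circle set \<Rightarrow> bool" where
  "open_circle U \<longleftrightarrow> open (circle_of -` U)"

instance
  by standard (auto simp: open_circle_def vimage_Union)

end

definition rotation :: "real \<Rightarrow> circle \<Rightarrow> circle" where
  "rotation \<alpha> z = z + circle_of \<alpha>"

text \<open>For \<open>b \<ge> a + 1\<close> the arc is the whole circle.\<close>

definition closed_arc :: "circle set \<Rightarrow> bool" where
  "closed_arc J \<longleftrightarrow> (\<exists>a b. a \<le> b \<and> J = circle_of ` {a..b})"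

definition finite_union_of_nondegenerate_arcs :: "circle set \<Rightarrow> bool" where
  "finite_union_of_nondegenerate_arcs I \<longleftrightarrow>
     (\<exists>F. finite F \<and> (\<forall>J\<in>F. closed_arc J \<and> interior J \<noteq> {}) \<and> I = \<Union>F)"

definition itinerary :: "real \<Rightarrow> circle set \<Rightarrow> nat \<Rightarrow> nat" where
  "itinerary \<alpha> I i = (if (rotation \<alpha> ^^ i) 0 \<in> I then 1 else 0)"

definition rotational_symmetry :: "nat \<Rightarrow> circle set \<Rightarrow> bool" where
  "rotational_symmetry n I \<longleftrightarrow> (\<lambda>z. z + circle_of (1 / real n)) ` I = I"

definition no_rotational_symmetries :: "circle set \<Rightarrow> bool" where
  "no_rotational_symmetries I \<longleftrightarrow> (\<forall>n\<ge>2. \<not> rotational_symmetry n I)"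

end

theory Submission
  imports Defs
begin

text \<open>
  Lift everything to the real line and let \<open>G\<close> be the closed subgroup of the plane generated by
  \<open>(\<alpha>1, \<alpha>2)\<close> and the integer lattice. By Dirichlet's theorem \<open>G\<close> is not discrete, so it contains a
  line, and this line is neither horizontal nor vertical since the sets are proper. Moving along it,
  equality of the itineraries extends by continuity to \<open>x \<in> I1 \<longleftrightarrow> y \<in> I2\<close> for all \<open>(x, y) \<in> G\<close>.
  If \<open>(0, y) \<in> G\<close>, then \<open>I2\<close> is invariant under translation by \<open>y\<close>, which forces \<open>y\<close> to be an
  integer, and likewise for \<open>(x, 0)\<close>. So the slope \<open>c\<close> of the line satisfies \<open>c \<in> \<int>\<close> and
  \<open>1 / c \<in> \<int>\<close>, that is \<open>c = \<plusminus>1\<close>, and \<open>\<alpha>2 - c \<alpha>1 \<in> \<int>\<close>.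
\<close>

section \<open>Lines inside closed subgroups of Euclidean space\<close>

text \<open>Arbitrarily short elements of \<open>G\<close>, scaled to unit length, have a limit
  direction \<open>w\<close> along a subsequence, because the sphere is compact. A suitable integer
  multiple of a short element \<open>g\<close> lies within \<open>norm g\<close> of \<open>t\<close>
  times its direction, so such multiples converge to \<open>t *\<^sub>R w\<close>, and closedness
  keeps the limit in \<open>G\<close>.\<close>

lemma closed_subgroup_contains_line:
  fixes G :: "'a::euclidean_space set"
  assumes "closed G" and zero: "0 \<in> G"
    and diff: "\<And>x y. x \<in> G \<Longrightarrow> y \<in> G \<Longrightarrow> x - y \<in> G"
    and small: "\<And>e. e > 0 \<Longrightarrow> \<exists>g\<in>G. 0 < norm g \<and> norm g < e"
  obtains w where "w \<noteq> 0" "\<And>t. t *\<^sub>R w \<in> G"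
proof -
  have uminus: "- x \<in> G" if "x \<in> G" for x
    using diff[OF zero that] by simp
  have add: "x + y \<in> G" if "x \<in> G" "y \<in> G" for x y
    using diff[OF that(1) uminus[OF that(2)]] by simp
  have nat_mult: "real n *\<^sub>R x \<in> G" if "x \<in> G" for x n
    by (induction n) (auto simp: zero scaleR_add_left intro: add that)
  have int_mult: "real_of_int k *\<^sub>R x \<in> G" if "x \<in> G" for x k
    using nat_mult[OF that] uminus[OF nat_mult[OF that]] by (cases k rule: int_cases2) auto
  have "\<exists>g\<in>G. 0 < norm g \<and> norm g < 1 / real (Suc n)" for n
    by (rule small) simp
  then obtain g where g: "\<And>n. g n \<in> G" "\<And>n. 0 < norm (g n)" "\<And>n. norm (g n) < 1 / real (Suc n)"
    by metis
  have "(\<lambda>n. 1 / real (Suc n)) \<longlonglongrightarrow> 0"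
    using LIMSEQ_inverse_real_of_nat by (simp add: inverse_eq_divide)
  moreover have "\<forall>n. norm (norm (g n)) \<le> 1 / real (Suc n)"
    unfolding real_norm_def abs_norm_cancel using less_imp_le[OF g(3)] by blast
  ultimately have g0: "(\<lambda>n. norm (g n)) \<longlonglongrightarrow> 0"
    by (intro Lim_null_comparison[of "\<lambda>n. norm (g n)" "\<lambda>n. 1 / real (Suc n)"] always_eventually)
  have "\<forall>n. g n /\<^sub>R norm (g n) \<in> sphere 0 1"
    using g(2) by simp
  then have "\<exists>w\<in>sphere 0 1. \<exists>r. strict_mono r \<and> ((\<lambda>n. g n /\<^sub>R norm (g n)) \<circ> r) \<longlonglongrightarrow> w"
    by (rule compact_sphere[of "0::'a" 1, unfolded compact_def, THEN spec, THEN mp])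
  then obtain w r where w: "w \<in> sphere (0::'a) 1" and r: "strict_mono r"
    and lim: "((\<lambda>n. g n /\<^sub>R norm (g n)) \<circ> r) \<longlonglongrightarrow> w"
    by blast
  have "t *\<^sub>R w \<in> G" for t
  proof -
    define h where "h = (\<lambda>n. norm (g (r n)))"
    have h: "h n > 0" for n using g(2) by (simp add: h_def)
    have h0: "h \<longlonglongrightarrow> 0"
      using LIMSEQ_subseq_LIMSEQ[OF g0 r] by (simp add: h_def o_def)
    have "norm (real_of_int \<lfloor>t / h n\<rfloor> * h n - t) \<le> h n" for n
    proof -
      have "norm (real_of_int \<lfloor>t / h n\<rfloor> * h n - t) = \<bar>real_of_int \<lfloor>t / h n\<rfloor> - t / h n\<bar> * h n"
        using h[of n] by (simp add: abs_mult[symmetric] field_simps abs_of_pos)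
      also have "\<dots> \<le> 1 * h n"
        using h[of n] by (intro mult_right_mono) (linarith, simp)
      finally show ?thesis by simp
    qed
    then have "(\<lambda>n. real_of_int \<lfloor>t / h n\<rfloor> * h n - t) \<longlonglongrightarrow> 0"
      by (intro Lim_null_comparison[OF _ h0]) simp
    then have "(\<lambda>n. real_of_int \<lfloor>t / h n\<rfloor> * h n) \<longlonglongrightarrow> t"
      using LIM_zero_iff by blast
    from tendsto_scaleR[OF this lim]
    have "(\<lambda>n. real_of_int \<lfloor>t / h n\<rfloor> *\<^sub>R g (r n)) \<longlonglongrightarrow> t *\<^sub>R w"
      using h by (simp add: o_def h_def mult.assoc)
    then show ?thesis
      by (rule closed_sequentially[OF \<open>closed G\<close> int_mult[OF g(1)]])
  qed
  moreover have "w \<noteq> 0" using w by auto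
  ultimately show thesis using that by blast
qed

section \<open>The plane group generated by the two rotation numbers and the lattice\<close>

text \<open>This is the preimage in the plane of the orbit of 0 under the torus translation by
  \<open>(\<alpha>, \<beta>)\<close>. The time \<open>n\<close> ranges over all integers, which
  makes it a group; an itinerary sees only \<open>n \<ge> 0\<close>.\<close>

definition joint_orbit :: "real \<Rightarrow> real \<Rightarrow> (real \<times> real) set" where
  "joint_orbit \<alpha> \<beta> = {(x, y). \<exists>n::int. x - of_int n * \<alpha> \<in> \<int> \<and> y - of_int n * \<beta> \<in> \<int>}"

lemma joint_orbit_0: "0 \<in> joint_orbit \<alpha> \<beta>"
  by (auto simp: joint_orbit_def zero_prod_def intro: exI[of _ 0])

lemma joint_orbit_Ints: "a \<in> \<int> \<Longrightarrow> b \<in> \<int> \<Longrightarrow> (a, b) \<in> joint_orbit \<alpha> \<beta>"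
  by (auto simp: joint_orbit_def intro: exI[of _ 0])

lemma joint_orbit_generator: "(\<alpha>, \<beta>) \<in> joint_orbit \<alpha> \<beta>"
  by (auto simp: joint_orbit_def intro: exI[of _ 1])

lemma joint_orbit_diff:
  assumes "p \<in> joint_orbit \<alpha> \<beta>" "q \<in> joint_orbit \<alpha> \<beta>"
  shows "p - q \<in> joint_orbit \<alpha> \<beta>"
proof -
  obtain x y x' y' n m where p: "p = (x, y)" "q = (x', y')"
    "x - of_int n * \<alpha> \<in> \<int>" "y - of_int n * \<beta> \<in> \<int>" "x' - of_int m * \<alpha> \<in> \<int>" "y' - of_int m * \<beta> \<in> \<int>"
    using assms by (auto simp: joint_orbit_def)
  have "(x - x') - of_int (n - m) * \<alpha> \<in> \<int>"
    using Ints_diff[OF p(3,5)] by (simp add: algebra_simps)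
  moreover have "(y - y') - of_int (n - m) * \<beta> \<in> \<int>"
    using Ints_diff[OF p(4,6)] by (simp add: algebra_simps)
  ultimately show ?thesis
    unfolding p(1,2) joint_orbit_def by (auto intro!: exI[of _ "n - m"])
qed

lemma closure_joint_orbit_diff:
  assumes "p \<in> closure (joint_orbit \<alpha> \<beta>)" "q \<in> closure (joint_orbit \<alpha> \<beta>)"
  shows "p - q \<in> closure (joint_orbit \<alpha> \<beta>)"
proof -
  obtain f g where "\<And>n. f n \<in> joint_orbit \<alpha> \<beta>" "f \<longlonglongrightarrow> p" "\<And>n. g n \<in> joint_orbit \<alpha> \<beta>" "g \<longlonglongrightarrow> q"
    using assms unfolding closure_sequential by blast
  then show ?thesis
    unfolding closure_sequential
    by (intro exI[of _ "\<lambda>n. f n - g n"]) (auto intro: joint_orbit_diff tendsto_diff)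
qed

lemma closure_joint_orbit_add:
  assumes "p \<in> closure (joint_orbit \<alpha> \<beta>)" "q \<in> closure (joint_orbit \<alpha> \<beta>)"
  shows "p + q \<in> closure (joint_orbit \<alpha> \<beta>)"
proof -
  have "0 \<in> closure (joint_orbit \<alpha> \<beta>)"
    using joint_orbit_0 closure_subset by blast
  from closure_joint_orbit_diff[OF assms(1) closure_joint_orbit_diff[OF this assms(2)]]
  show ?thesis by simp
qed

text \<open>Exchanging the coordinates transfers facts about vertical directions to horizontal
  ones.\<close>

lemma closure_joint_orbit_swap:
  assumes "(x, y) \<in> closure (joint_orbit \<alpha> \<beta>)"
  shows "(y, x) \<in> closure (joint_orbit \<beta> \<alpha>)"
proof -
  obtain f where f: "\<And>n. f n \<in> joint_orbit \<alpha> \<beta>" "f \<longlonglongrightarrow> (x, y)"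
    using assms unfolding closure_sequential by blast
  have "(\<lambda>n. prod.swap (f n)) \<longlonglongrightarrow> (y, x)"
    using tendsto_Pair[OF tendsto_snd[OF f(2)] tendsto_fst[OF f(2)]] by (simp add: prod.swap_def)
  moreover have "prod.swap (f n) \<in> joint_orbit \<beta> \<alpha>" for n
    using f(1)[of n] by (auto simp: joint_orbit_def)
  ultimately show ?thesis
    unfolding closure_sequential by (intro exI[of _ "\<lambda>n. prod.swap (f n)"]) simp
qed

section \<open>Diophantine approximation and density\<close>

lemma Dirichlet_approx_pair:
  fixes \<alpha> \<beta> e :: real
  assumes "e > 0"
  obtains q a b :: int where "q > 0" "\<bar>of_int q * \<alpha> - of_int a\<bar> < e" "\<bar>of_int q * \<beta> - of_int b\<bar> < e"
proof -
  obtain N :: nat where N: "N > 0" "1 / real N < e"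
    using real_arch_inverse[of e] assms by (metis gr_zeroI inverse_eq_divide)
  obtain q p where q: "0 < q"
    "\<And>i::nat. i < 2 \<Longrightarrow> \<bar>of_int q * (if i = 0 then \<alpha> else \<beta>) - of_int (p i)\<bar> < 1 / real N"
    by (rule Dirichlet_approx_simult[OF N(1), of 2 "\<lambda>i. if i = 0 then \<alpha> else \<beta>"]) blast
  show thesis
    using that[of q "p 0" "p 1"] q(1) q(2)[of 0] q(2)[of 1] N(2) by simp
qed

text \<open>Dirichlet's theorem brings a multiple of \<open>(\<alpha>, \<beta>)\<close> close to the
  lattice, and irrationality of \<open>\<alpha>\<close> keeps the difference nonzero. Hence the
  group is not discrete.\<close>

lemma joint_orbit_small:
  assumes "\<alpha> \<notin> \<rat>" "e > 0"
  shows "\<exists>g \<in> joint_orbit \<alpha> \<beta>. 0 < norm g \<and> norm g < e"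
proof -
  \<comment> \<open>The tolerance is halved because the norm of a pair is bounded by the sum of the
    two coordinate errors.\<close>
  obtain q a b :: int where q: "q > 0" "\<bar>of_int q * \<alpha> - of_int a\<bar> < e / 2"
    "\<bar>of_int q * \<beta> - of_int b\<bar> < e / 2"
    using Dirichlet_approx_pair[of "e / 2" \<alpha> \<beta>] \<open>e > 0\<close> by auto
  define g where "g = (of_int q * \<alpha> - of_int a, of_int q * \<beta> - of_int b)"
  have "of_int q * \<alpha> - of_int a \<noteq> 0"
  proof
    assume "of_int q * \<alpha> - of_int a = 0"
    then have "\<alpha> = of_int a / of_int q"
      using q(1) by (simp add: field_simps)
    then show False using assms(1) by auto
  qed
  then have "0 < norm g" by (simp add: g_def zero_prod_def)
  moreover have "norm g < e"
    using norm_Pair_le[of "of_int q * \<alpha> - of_int a" "of_int q * \<beta> - of_int b"] q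
    by (simp add: g_def)
  moreover have "g \<in> joint_orbit \<alpha> \<beta>"
    by (auto simp: joint_orbit_def g_def intro!: exI[of _ q])
  ultimately show ?thesis by blast
qed

text \<open>Kronecker's density of the multiples of an irrational modulo 1, phrased for open sets;
  it is applied to interiors and to complements of closed sets.\<close>

lemma open_meets_orbit_mod_1:
  fixes \<alpha> :: real
  assumes "\<alpha> \<notin> \<rat>" "open U" "x \<in> U"
  obtains k h :: int where "of_int k * \<alpha> - of_int h \<in> U"
proof -
  obtain e where e: "e > 0" "\<And>y. dist y x < e \<Longrightarrow> y \<in> U"
    using assms(2,3) unfolding open_dist by blast
  obtain h k :: int where "\<bar>of_int k * \<alpha> - of_int h - x\<bar> < e"
    using sequence_of_fractional_parts_is_dense[OF assms(1) e(1)] by metis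
  then show thesis
    using that[of k h] e(2) by (simp add: dist_real_def)
qed

section \<open>Periods of closed sets of reals\<close>

text \<open>The numbers \<open>k * t - h\<close> with integers \<open>k\<close>, \<open>h\<close>
  are all periods of \<open>T\<close>. If \<open>t\<close> were irrational, they would carry a point
  of \<open>T\<close> into the open complement. If \<open>t = p / q\<close> in lowest terms, Bezout
  makes \<open>1 / q\<close> a period, which \<open>asym\<close> rules out unless
  \<open>q = 1\<close>.\<close>

lemma translation_invariant_Ints:
  fixes T :: "real set" and t :: real
  assumes "closed T" "T \<noteq> {}" "T \<noteq> UNIV"
    and per: "\<And>x y. x - y \<in> \<int> \<Longrightarrow> x \<in> T \<longleftrightarrow> y \<in> T"
    and asym: "\<And>n::nat. n \<ge> 2 \<Longrightarrow> \<exists>x. \<not> (x \<in> T \<longleftrightarrow> x + 1 / real n \<in> T)"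
    and inv: "\<And>x. x \<in> T \<longleftrightarrow> x + t \<in> T"
  shows "t \<in> \<int>"
proof -
  have inv_nat: "x \<in> T \<longleftrightarrow> x + real n * t \<in> T" for x n
  proof (induction n)
    case (Suc n)
    then show ?case using inv[of "x + real n * t"] by (simp add: algebra_simps)
  qed simp
  have inv_int: "x \<in> T \<longleftrightarrow> x + of_int k * t \<in> T" for x k
  proof (cases k rule: int_cases2)
    case (nonneg n)
    then show ?thesis using inv_nat[of x n] by simp
  next
    case (nonpos n)
    then show ?thesis using inv_nat[of "x - real n * t" n] by simp
  qed
  have inv_gen: "x \<in> T \<longleftrightarrow> x + of_int k * t - of_int h \<in> T" for x k h
    using inv_int[of x k] per[of "x + of_int k * t" "x + of_int k * t - of_int h"] by simp
  have "t \<in> \<rat>"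
  proof (rule ccontr)
    assume irr: "t \<notin> \<rat>"
    obtain x0 y0 where x0: "x0 \<in> T" and y0: "y0 \<notin> T" using assms(2,3) by auto
    \<comment> \<open>Shifting by \<open>x0\<close> reduces density of the orbit of
      \<open>x0\<close> to density of the orbit of 0.\<close>
    have "open ((\<lambda>s. s + x0) -` (- T))"
      by (intro continuous_open_vimage) (use \<open>closed T\<close> in \<open>auto intro!: continuous_intros\<close>)
    moreover have "y0 - x0 \<in> (\<lambda>s. s + x0) -` (- T)"
      using y0 by simp
    ultimately obtain k h :: int where "of_int k * t - of_int h \<in> (\<lambda>s. s + x0) -` (- T)"
      using open_meets_orbit_mod_1[OF irr] by metis
    then show False
      using x0 inv_gen[of x0 k h] by (simp add: algebra_simps)
  qed
  then obtain p q :: int where q: "q > 0" "coprime p q" "t = of_int p / of_int q"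
    by (meson Rats_cases')
  show ?thesis
  proof (cases "q = 1")
    case True
    then show ?thesis using q by simp
  next
    case False
    obtain u v where "u * p + v * q = 1"
      using q(2) by (metis bezout_int coprime_imp_gcd_eq_1)
    then have "real_of_int u * of_int p + of_int v * of_int q = 1"
      by (metis of_int_1 of_int_add of_int_mult)
    then have "of_int u * t - of_int (- v) = 1 / real (nat q)"
      using q(1) unfolding q(3) by (simp add: field_simps)
    then have sym: "x \<in> T \<longleftrightarrow> x + 1 / real (nat q) \<in> T" for x
      using inv_gen[of x u "- v"] by (simp add: add_diff_eq[symmetric] del: of_int_minus)
    have "nat q \<ge> 2" using False q(1) by linarith
    then show ?thesis using asym sym by blast
  qed
qed

section \<open>Lifted sets with equal itineraries\<close>

text \<open>\<open>S\<close> and \<open>T\<close> model the preimages in the real line of the two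
  circle sets. Finite unions of nondegenerate arcs are abstracted to regular closed sets by
  \<open>closed\<close> and \<open>regular\<close>. The conditions are symmetric in the two sides,
  so every result can be reused with the roles exchanged.\<close>

locale matched_lifts =
  fixes \<alpha> \<beta> :: real and S T :: "real set"
  assumes irr: "\<alpha> \<notin> \<rat>" "\<beta> \<notin> \<rat>"
    and closed: "closed S" "closed T"
    and regular: "S \<subseteq> closure (interior S)" "T \<subseteq> closure (interior T)"
    and nonempty: "S \<noteq> {}" "T \<noteq> {}"
    and proper: "S \<noteq> UNIV" "T \<noteq> UNIV"
    and per: "\<And>x y. x - y \<in> \<int> \<Longrightarrow> x \<in> S \<longleftrightarrow> y \<in> S" "\<And>x y. x - y \<in> \<int> \<Longrightarrow> x \<in> T \<longleftrightarrow> y \<in> T"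
    and asym: "\<And>n::nat. n \<ge> 2 \<Longrightarrow> \<exists>x. \<not> (x \<in> S \<longleftrightarrow> x + 1 / real n \<in> S)"
      "\<And>n::nat. n \<ge> 2 \<Longrightarrow> \<exists>x. \<not> (x \<in> T \<longleftrightarrow> x + 1 / real n \<in> T)"
    and itineraries: "\<And>n::nat. real n * \<alpha> \<in> S \<longleftrightarrow> real n * \<beta> \<in> T"
begin

abbreviation G :: "(real \<times> real) set" where
  "G \<equiv> closure (joint_orbit \<alpha> \<beta>)"

lemma swap: "matched_lifts \<beta> \<alpha> T S"
  using irr closed regular nonempty proper per asym itineraries
  by (intro matched_lifts.intro) blast+

lemma Ints_in_G: "a \<in> \<int> \<Longrightarrow> b \<in> \<int> \<Longrightarrow> (a, b) \<in> G"
  using joint_orbit_Ints closure_subset by blast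

text \<open>Only non-negative times are recorded by the itinerary; negative times are reached by adding
  \<open>\<bar>n\<bar>\<close> times a return time \<open>q\<close> for which \<open>q \<alpha>\<close> and \<open>q \<beta>\<close> are both almost integers.\<close>

lemma interior_imp_mem_orbit:
  assumes xy: "(x, y) \<in> joint_orbit \<alpha> \<beta>" and x: "x \<in> interior S"
  shows "y \<in> T"
proof (rule ccontr)
  assume "y \<notin> T"
  obtain n :: int where n: "x - of_int n * \<alpha> \<in> \<int>" "y - of_int n * \<beta> \<in> \<int>"
    using xy by (auto simp: joint_orbit_def)
  obtain d where d: "d > 0" "\<And>z. dist z x < d \<Longrightarrow> z \<in> interior S"
    using open_interior[of S] x unfolding open_dist by blast
  have "open (- T)" using closed by auto
  then obtain d' where d': "d' > 0" "\<And>z. dist z y < d' \<Longrightarrow> z \<notin> T"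
    using \<open>y \<notin> T\<close> unfolding open_dist by (metis ComplD ComplI)
  \<comment> \<open>The return error gets multiplied by \<open>\<bar>n\<bar>\<close>; adding 1 to
    the denominator makes the bounds strict and covers \<open>n = 0\<close>.\<close>
  define e where "e = min d d' / (\<bar>of_int n\<bar> + 1)"
  have e: "e > 0" "of_int \<bar>n\<bar> * e < d" "of_int \<bar>n\<bar> * e < d'"
  proof -
    show "e > 0" using d(1) d'(1) by (simp add: e_def)
    moreover have "(of_int \<bar>n\<bar> + 1) * e = min d d'"
      unfolding e_def by simp
    ultimately show "of_int \<bar>n\<bar> * e < d" "of_int \<bar>n\<bar> * e < d'"
      by (auto simp: distrib_right)
  qed
  obtain q a b :: int where q: "q > 0" "\<bar>of_int q * \<alpha> - of_int a\<bar> < e" "\<bar>of_int q * \<beta> - of_int b\<bar> < e"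
    using Dirichlet_approx_pair[OF e(1)] by blast
  define m where "m = nat (n + \<bar>n\<bar> * q)"
  \<comment> \<open>Since \<open>q \<ge> 1\<close>, the integer \<open>n + \<bar>n\<bar> * q\<close>
    is non-negative and \<open>nat\<close> truncates nothing.\<close>
  have "\<bar>n\<bar> * 1 \<le> \<bar>n\<bar> * q" using q(1) by (intro mult_left_mono) auto
  then have m: "real m = of_int n + of_int \<bar>n\<bar> * of_int q"
    unfolding m_def by (simp add: of_nat_nat)
  \<comment> \<open>\<open>x'\<close> and \<open>y'\<close> represent \<open>m * \<alpha>\<close>
    and \<open>m * \<beta>\<close> modulo 1, and differ from \<open>x\<close> and \<open>y\<close>
    by at most \<open>\<bar>n\<bar> * e\<close>.\<close>
  define x' where "x' = x + of_int \<bar>n\<bar> * (of_int q * \<alpha> - of_int a)"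
  define y' where "y' = y + of_int \<bar>n\<bar> * (of_int q * \<beta> - of_int b)"
  have close: "\<bar>of_int \<bar>n\<bar> * r\<bar> \<le> of_int \<bar>n\<bar> * e" if "\<bar>r\<bar> < e" for r
    using that by (simp add: abs_mult mult_left_mono)
  have "x' \<in> S"
    using d(2)[of x'] close[OF q(2)] e(2) interior_subset
    by (auto simp: x'_def dist_real_def)
  moreover have "x' - real m * \<alpha> = (x - of_int n * \<alpha>) - of_int (\<bar>n\<bar> * a)"
    by (simp add: x'_def m algebra_simps)
  then have "x' - real m * \<alpha> \<in> \<int>" using n(1) by (metis Ints_diff Ints_of_int)
  moreover have "y' - real m * \<beta> = (y - of_int n * \<beta>) - of_int (\<bar>n\<bar> * b)"
    by (simp add: y'_def m algebra_simps)
  then have "y' - real m * \<beta> \<in> \<int>" using n(2) by (metis Ints_diff Ints_of_int)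
  moreover have "y' \<notin> T"
    using d'(2)[of y'] close[OF q(3)] e(3) by (simp add: y'_def dist_real_def)
  ultimately show False
    using per itineraries[of m] by blast
qed

text \<open>For orbit points tending to \<open>(x, y)\<close>, openness of \<open>interior S\<close>
  eventually captures the first coordinates, and closedness of \<open>T\<close> retains the limit of
  the second ones.\<close>

lemma interior_imp_mem:
  assumes "(x, y) \<in> G" "x \<in> interior S"
  shows "y \<in> T"
proof -
  obtain f where f: "\<And>n. f n \<in> joint_orbit \<alpha> \<beta>" "f \<longlonglongrightarrow> (x, y)"
    using assms(1) unfolding closure_sequential by blast
  have fst: "(\<lambda>n. fst (f n)) \<longlonglongrightarrow> x" and snd: "(\<lambda>n. snd (f n)) \<longlonglongrightarrow> y"
    using tendsto_fst[OF f(2)] tendsto_snd[OF f(2)] by simp_all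
  have "\<forall>\<^sub>F n in sequentially. fst (f n) \<in> interior S"
    using topological_tendstoD[OF fst open_interior assms(2)] .
  then have "\<forall>\<^sub>F n in sequentially. snd (f n) \<in> T"
    by eventually_elim (use f(1) interior_imp_mem_orbit in \<open>metis prod.collapse\<close>)
  then show ?thesis
    using Lim_in_closed_set[OF closed(2) _ _ snd] by simp
qed

text \<open>By density some orbit point has its first coordinate in \<open>interior S\<close>.
  Adding the vertical line to it would put every real number into \<open>T\<close>.\<close>

lemma vertical_line_not_in_G:
  assumes "\<And>t. (0, t) \<in> G"
  shows False
proof -
  have "interior S \<noteq> {}" using regular nonempty by auto
  then obtain k h :: int where kh: "of_int k * \<alpha> - of_int h \<in> interior S"
    using open_meets_orbit_mod_1[OF irr(1) open_interior] by blast
  define x where "x = of_int k * \<alpha> - of_int h"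
  have "(x, of_int k * \<beta>) \<in> joint_orbit \<alpha> \<beta>"
    by (auto simp: joint_orbit_def x_def intro!: exI[of _ k])
  then have "(x, of_int k * \<beta>) \<in> G" using closure_subset by blast
  from closure_joint_orbit_add[OF this assms[of "y - of_int k * \<beta>" for y]]
  have "(x, y) \<in> G" for y by simp
  then have "y \<in> T" for y using interior_imp_mem kh x_def by blast
  then show False using proper by blast
qed

text \<open>A line in \<open>G\<close> exists by non-discreteness. It is not vertical by
  \<open>vertical_line_not_in_G\<close>, and not horizontal by the same lemma with the roles
  exchanged, so it has a finite nonzero slope.\<close>

lemma line_in_G:
  obtains c where "c \<noteq> 0" "\<And>t. (t, c * t) \<in> G"
proof -
  have "0 \<in> G" using joint_orbit_0 closure_subset by blast
  moreover have "\<exists>g\<in>G. 0 < norm g \<and> norm g < e" if "e > 0" for e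
    using joint_orbit_small[OF irr(1) that] closure_subset by blast
  ultimately obtain w where w: "w \<noteq> 0" "\<And>t. t *\<^sub>R w \<in> G"
    using closed_subgroup_contains_line[of G] closure_joint_orbit_diff by blast
  obtain u v where uv: "w = (u, v)" by (cases w)
  interpret sw: matched_lifts \<beta> \<alpha> T S by (rule swap)
  have "u \<noteq> 0"
  proof
    assume "u = 0"
    then have "v \<noteq> 0" using w(1) uv by (simp add: zero_prod_def)
    then have "(0, t) \<in> G" for t
      using w(2)[of "t / v"] uv \<open>u = 0\<close> by simp
    then show False by (rule vertical_line_not_in_G)
  qed
  moreover have "v \<noteq> 0"
  proof
    assume "v = 0"
    then have "(t, 0) \<in> G" for t
      using w(2)[of "t / u"] uv \<open>u \<noteq> 0\<close> by simp
    then have "(0, t) \<in> sw.G" for t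
      by (rule closure_joint_orbit_swap)
    then show False by (rule sw.vertical_line_not_in_G)
  qed
  moreover have "(t, v / u * t) \<in> G" for t
    using w(2)[of "t / u"] uv \<open>u \<noteq> 0\<close> by (simp add: mult.commute)
  ultimately show thesis using that[of "v / u"] by simp
qed

text \<open>A boundary point of \<open>S\<close> is a limit of interior points by regularity. Moving
  \<open>(x, y)\<close> along the line in \<open>G\<close> to these first coordinates gives points
  of \<open>T\<close> that converge to \<open>y\<close>.\<close>

lemma mem_imp_mem:
  assumes "(x, y) \<in> G" "x \<in> S"
  shows "y \<in> T"
proof -
  obtain c where c: "\<And>t. (t, c * t) \<in> G" by (rule line_in_G) blast
  obtain f where f: "\<And>n. f n \<in> interior S" "f \<longlonglongrightarrow> x"
    using assms(2) regular(1) closure_sequential[of x "interior S"] by blast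
  have "(f n, y + c * (f n - x)) \<in> G" for n
    using closure_joint_orbit_add[OF assms(1) c[of "f n - x"]] by simp
  then have "y + c * (f n - x) \<in> T" for n
    using f(1) interior_imp_mem by blast
  moreover have "(\<lambda>n. y + c * (f n - x)) \<longlonglongrightarrow> y + c * (x - x)"
    by (intro tendsto_intros f(2))
  ultimately have "y + c * (x - x) \<in> T"
    by (rule closed_sequentially[OF closed(2)])
  then show ?thesis by simp
qed

lemma mem_iff_mem:
  assumes "(x, y) \<in> G"
  shows "x \<in> S \<longleftrightarrow> y \<in> T"
proof -
  interpret sw: matched_lifts \<beta> \<alpha> T S by (rule swap)
  show ?thesis
    using mem_imp_mem[OF assms] sw.mem_imp_mem[OF closure_joint_orbit_swap[OF assms]] by blast
qed

text \<open>The line supplies a point of \<open>G\<close> at every height \<open>y\<close>. Adding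
  \<open>(0, t)\<close> leaves its first coordinate unchanged, so membership of \<open>y\<close> and
  of \<open>y + t\<close> in \<open>T\<close> is decided by the same point of \<open>S\<close>; thus
  \<open>t\<close> is a period of \<open>T\<close>.\<close>

lemma vertical_fibre_Ints:
  assumes "(0, t) \<in> G"
  shows "t \<in> \<int>"
proof (rule translation_invariant_Ints[OF closed(2) nonempty(2) proper(2) per(2) asym(2)])
  fix y
  obtain c where c: "c \<noteq> 0" "\<And>t. (t, c * t) \<in> G" by (rule line_in_G) blast
  have 1: "(y / c, y) \<in> G" using c(2)[of "y / c"] c(1) by simp
  from closure_joint_orbit_add[OF this assms] have 2: "(y / c, y + t) \<in> G" by simp
  show "y \<in> T \<longleftrightarrow> y + t \<in> T"
    using mem_iff_mem[OF 1] mem_iff_mem[OF 2] by simp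
qed

text \<open>Differences of points of \<open>G\<close> are arranged to land on an axis, where
  \<open>vertical_fibre_Ints\<close> or its swapped form applies: \<open>(1, c) - (1, 0)\<close> and
  \<open>(1 / c, 1) - (0, 1)\<close> determine \<open>c\<close>, and
  \<open>(\<alpha>, \<beta>) - (\<alpha>, c * \<alpha>)\<close> relates the rotation
  numbers.\<close>

lemma rotation_numbers_eq_or_opposite:
  obtains c :: real where "c = 1 \<or> c = -1" "\<beta> - c * \<alpha> \<in> \<int>" "\<And>x. x \<in> S \<longleftrightarrow> c * x \<in> T"
proof -
  interpret sw: matched_lifts \<beta> \<alpha> T S by (rule swap)
  obtain c where c: "c \<noteq> 0" "\<And>t. (t, c * t) \<in> G" by (rule line_in_G) blast
  have "(0, c) \<in> G"
    using closure_joint_orbit_diff[OF c(2)[of 1] Ints_in_G[of 1 0]] by simp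
  then have cZ: "c \<in> \<int>" by (rule vertical_fibre_Ints)
  have "(1 / c, 0) \<in> G"
    using closure_joint_orbit_diff[OF c(2)[of "1 / c"] Ints_in_G[of 0 1]] c(1) by simp
  then have "1 / c \<in> \<int>"
    by (rule sw.vertical_fibre_Ints[OF closure_joint_orbit_swap])
  with cZ obtain i j :: int where ij: "c = of_int i" "1 / c = of_int j"
    by (auto elim!: Ints_cases)
  then have "of_int (i * j) = (1::real)" 
    using c(1) by (simp add: ij[symmetric])
  then have "i * j = 1" by linarith
  then have "i = 1 \<or> i = -1" by (auto simp: zmult_eq_1_iff)
  then have "c = 1 \<or> c = -1" using ij(1) by auto
  moreover have "(\<alpha>, \<beta>) \<in> G" using joint_orbit_generator closure_subset by blast
  from closure_joint_orbit_diff[OF this c(2)[of \<alpha>]]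
  have "\<beta> - c * \<alpha> \<in> \<int>" by (intro vertical_fibre_Ints) simp
  ultimately show thesis
    by (rule that) (rule mem_iff_mem[OF c(2)])
qed

end

section \<open>Lifting circle sets to the real line\<close>

lemma circle_of_eq_iff: "circle_of x = circle_of y \<longleftrightarrow> x - y \<in> \<int>"
  by (rule circle.abs_eq_iff)

lemma circle_of_cases: obtains x where "z = circle_of x"
  by (induction z rule: circle.abs_induct) blast

lemma rotation_power: "(rotation \<alpha> ^^ n) 0 = circle_of (real n * \<alpha>)"
  by (induction n)
     (simp_all add: rotation_def zero_circle.abs_eq plus_circle.abs_eq algebra_simps)

lemma itinerary_eq_iff:
  "itinerary \<alpha> I = itinerary \<beta> J \<longleftrightarrow>
    (\<forall>n::nat. circle_of (real n * \<alpha>) \<in> I \<longleftrightarrow> circle_of (real n * \<beta>) \<in> J)"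
  unfolding fun_eq_iff itinerary_def rotation_power by auto

text \<open>The right side is the sum of a compact interval and the closed set
  \<open>\<int>\<close>, the shape from which \<open>compact_closed_sums\<close> yields
  closedness.\<close>

lemma vimage_circle_of_arc:
  "circle_of -` (circle_of ` {a..b}) = (\<Union>x\<in>{a..b}. \<Union>k\<in>\<int>. {x + k})"
proof (intro set_eqI iffI)
  fix x assume "x \<in> circle_of -` (circle_of ` {a..b})"
  then obtain s where s: "s \<in> {a..b}" "x - s \<in> \<int>" by (auto simp: circle_of_eq_iff)
  then show "x \<in> (\<Union>x\<in>{a..b}. \<Union>k\<in>\<int>. {x + k})"
    by (intro UN_I[of s] UN_I[of "x - s"]) auto
next
  fix x assume "x \<in> (\<Union>x\<in>{a..b}. \<Union>k\<in>\<int>. {x + k})"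
  then obtain s where "s \<in> {a..b}" "x - s \<in> \<int>" by auto
  then show "x \<in> circle_of -` (circle_of ` {a..b})"
    by (auto simp: circle_of_eq_iff)
qed

lemma closed_vimage_closed_arc:
  assumes "closed_arc J"
  shows "closed (circle_of -` J)"
proof -
  obtain a b where "J = circle_of ` {a..b}" using assms by (auto simp: closed_arc_def)
  then show ?thesis
    by (simp only: vimage_circle_of_arc) (intro compact_closed_sums; simp)
qed

text \<open>Nonempty interior forces \<open>a < b\<close>, since a coset of \<open>\<int>\<close>
  contains no interval. Each point of the preimage then lies in an integer translate of
  \<open>{a..b}\<close>, which is the closure of an open interval inside the preimage.\<close>

lemma regular_vimage_closed_arc:
  assumes "closed_arc J" "interior J \<noteq> {}"
  shows "circle_of -` J \<subseteq> closure (interior (circle_of -` J))"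
proof
  fix x assume x: "x \<in> circle_of -` J"
  obtain a b where ab: "a \<le> b" "J = circle_of ` {a..b}" using assms by (auto simp: closed_arc_def)
  have "a < b"
  proof (rule ccontr)
    assume "\<not> a < b"
    then have "{a..b} = {a}" using ab(1) by auto
    obtain z where "z \<in> interior J" using assms(2) by blast
    obtain s where s: "z = circle_of s" by (rule circle_of_cases)
    have "open (circle_of -` interior J)"
      using open_interior[of J] by (simp add: open_circle_def)
    moreover have "s \<in> circle_of -` interior J" using \<open>z \<in> interior J\<close> s by simp
    ultimately obtain e where e: "e > 0" "ball s e \<subseteq> circle_of -` interior J"
      unfolding open_contains_ball by blast
    have sub: "ball s e \<subseteq> {y. y - a \<in> \<int>}"
    proof
      fix y assume "y \<in> ball s e"
      then have "circle_of y \<in> J" using e(2) interior_subset[of J] by blast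
      then show "y \<in> {y. y - a \<in> \<int>}"
        unfolding ab(2) \<open>{a..b} = {a}\<close> by (simp add: circle_of_eq_iff)
    qed
    \<comment> \<open>A step inside the ball and strictly between 0 and 1 cannot join two points of
      one coset of \<open>\<int>\<close>.\<close>
    define d where "d = min (e / 2) (1 / 2)"
    have "s \<in> ball s e" "s + d \<in> ball s e"
      using e(1) by (auto simp: d_def dist_real_def min_def)
    with sub have "s - a \<in> \<int>" "s + d - a \<in> \<int>" by blast+
    then have "(s + d - a) - (s - a) \<in> \<int>" by (rule Ints_diff[rotated])
    then have "d \<in> \<int>" by simp
    moreover have "0 < d" "d < 1" using e(1) by (auto simp: d_def)
    ultimately show False by (auto elim!: Ints_cases)
  qed
  obtain s where s: "s \<in> {a..b}" "x - s \<in> \<int>" using x ab(2) by (auto simp: circle_of_eq_iff)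
  define k where "k = x - s"
  have "{a + k<..<b + k} \<subseteq> circle_of -` J"
  proof
    fix y assume "y \<in> {a + k<..<b + k}"
    then show "y \<in> circle_of -` J"
      unfolding ab(2) using s(2)
      by (intro vimageI2 image_eqI[of _ _ "y - k"]) (auto simp: circle_of_eq_iff k_def)
  qed
  then have "{a + k<..<b + k} \<subseteq> interior (circle_of -` J)"
    by (intro interior_maximal) auto
  then have "closure {a + k<..<b + k} \<subseteq> closure (interior (circle_of -` J))"
    by (rule closure_mono)
  moreover have "x \<in> closure {a + k<..<b + k}"
    using s(1) \<open>a < b\<close> by (simp add: k_def)
  ultimately show "x \<in> closure (interior (circle_of -` J))" by blast
qed

lemma
  assumes "finite_union_of_nondegenerate_arcs I"
  shows closed_vimage_arcs: "closed (circle_of -` I)"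
    and regular_vimage_arcs: "circle_of -` I \<subseteq> closure (interior (circle_of -` I))"
proof -
  obtain F where F: "finite F" "\<And>J. J \<in> F \<Longrightarrow> closed_arc J" "\<And>J. J \<in> F \<Longrightarrow> interior J \<noteq> {}"
    "I = \<Union>F"
    using assms by (auto simp: finite_union_of_nondegenerate_arcs_def)
  show "closed (circle_of -` I)"
    unfolding F(4) vimage_Union using F(1,2) by (intro closed_UN) (auto intro: closed_vimage_closed_arc)
  show "circle_of -` I \<subseteq> closure (interior (circle_of -` I))"
  proof
    fix x assume "x \<in> circle_of -` I"
    then obtain J where J: "J \<in> F" "x \<in> circle_of -` J" using F(4) by auto
    then have "x \<in> closure (interior (circle_of -` J))"
      using regular_vimage_closed_arc F(2,3) by blast
    moreover have "closure (interior (circle_of -` J)) \<subseteq> closure (interior (circle_of -` I))"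
      using J(1) F(4) by (intro closure_mono interior_mono) auto
    ultimately show "x \<in> closure (interior (circle_of -` I))" by blast
  qed
qed

lemma no_rotational_symmetries_vimage:
  assumes "no_rotational_symmetries I" "n \<ge> 2"
  shows "\<exists>x. \<not> (x \<in> circle_of -` I \<longleftrightarrow> x + 1 / real n \<in> circle_of -` I)"
proof (rule ccontr)
  assume *: "\<nexists>x. \<not> (x \<in> circle_of -` I \<longleftrightarrow> x + 1 / real n \<in> circle_of -` I)"
  have **: "z \<in> I \<longleftrightarrow> z + circle_of (1 / real n) \<in> I" for z
  proof -
    obtain x where "z = circle_of x" by (rule circle_of_cases)
    moreover have "x \<in> circle_of -` I \<longleftrightarrow> x + 1 / real n \<in> circle_of -` I" using * by blast
    ultimately show ?thesis by (simp add: plus_circle.abs_eq)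
  qed
  have "(\<lambda>z. z + circle_of (1 / real n)) ` I = I"
  proof (intro set_eqI iffI)
    fix z assume "z \<in> I"
    then show "z \<in> (\<lambda>z. z + circle_of (1 / real n)) ` I"
      using **[of "z - circle_of (1 / real n)"]
      by (intro image_eqI[of _ _ "z - circle_of (1 / real n)"]) simp_all
  next
    fix z assume "z \<in> (\<lambda>z. z + circle_of (1 / real n)) ` I"
    then show "z \<in> I" using ** by blast
  qed
  then show False
    using assms by (auto simp: no_rotational_symmetries_def rotational_symmetry_def)
qed

lemma matched_lifts_vimage:
  assumes "\<alpha> \<notin> \<rat>" "\<beta> \<notin> \<rat>"
    and "finite_union_of_nondegenerate_arcs I" "I \<noteq> {}" "I \<noteq> UNIV" "no_rotational_symmetries I"
    and "finite_union_of_nondegenerate_arcs J" "J \<noteq> {}" "J \<noteq> UNIV" "no_rotational_symmetries J"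
    and "itinerary \<alpha> I = itinerary \<beta> J"
  shows "matched_lifts \<alpha> \<beta> (circle_of -` I) (circle_of -` J)"
proof -
  have ne: "circle_of -` K \<noteq> {}" if "K \<noteq> {}" for K
  proof -
    obtain z where "z \<in> K" using \<open>K \<noteq> {}\<close> by blast
    moreover obtain x where "z = circle_of x" by (rule circle_of_cases)
    ultimately show ?thesis by blast
  qed
  have ne_UNIV: "circle_of -` K \<noteq> UNIV" if "K \<noteq> UNIV" for K
    using ne[of "- K"] that by auto
  have per: "x \<in> circle_of -` K \<longleftrightarrow> y \<in> circle_of -` K" if "x - y \<in> \<int>" for x y K
    using that circle_of_eq_iff[of x y] by simp
  have itin: "real n * \<alpha> \<in> circle_of -` I \<longleftrightarrow> real n * \<beta> \<in> circle_of -` J" for n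
    using assms(11) by (simp add: itinerary_eq_iff)
  show ?thesis
    by (rule matched_lifts.intro)
       (fact assms(1) assms(2) closed_vimage_arcs[OF assms(3)] closed_vimage_arcs[OF assms(7)]
          regular_vimage_arcs[OF assms(3)] regular_vimage_arcs[OF assms(7)]
          ne[OF assms(4)] ne[OF assms(8)] ne_UNIV[OF assms(5)] ne_UNIV[OF assms(9)] itin
        | erule per no_rotational_symmetries_vimage[OF assms(6)]
          no_rotational_symmetries_vimage[OF assms(10)])+
qed

section \<open>Fractional parts and the equivalence\<close>

lemma frac_eq_frac_iff: "frac x = frac y \<longleftrightarrow> x - y \<in> \<int>" for x y :: real
proof
  assume "x - y \<in> \<int>"
  then obtain k where "x = y + of_int k" by (metis Ints_cases add_diff_cancel_left' diff_add_cancel add.commute)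
  then show "frac x = frac y" by (simp add: frac_def)
next
  assume "frac x = frac y"
  then have "x - y = of_int (\<lfloor>x\<rfloor> - \<lfloor>y\<rfloor>)" by (simp add: frac_def)
  then show "x - y \<in> \<int>" by (metis Ints_of_int)
qed

theorem corollary2:
  fixes \<alpha>1 \<alpha>2 :: real and I1 I2 :: "circle set"
  assumes "\<alpha>1 \<notin> \<rat>" and "\<alpha>2 \<notin> \<rat>"
    and "finite_union_of_nondegenerate_arcs I1" and "I1 \<noteq> {}" and "I1 \<noteq> UNIV"
    and "no_rotational_symmetries I1"
    and "finite_union_of_nondegenerate_arcs I2" and "I2 \<noteq> {}" and "I2 \<noteq> UNIV"
    and "no_rotational_symmetries I2"
  shows "itinerary \<alpha>1 I1 = itinerary \<alpha>2 I2 \<longleftrightarrow>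
    (frac \<alpha>1 = frac \<alpha>2 \<and> I1 = I2) \<or>
    (frac \<alpha>1 = 1 - frac \<alpha>2 \<and> I1 = uminus ` I2)"
proof
  assume "itinerary \<alpha>1 I1 = itinerary \<alpha>2 I2"
  then interpret matched_lifts \<alpha>1 \<alpha>2 "circle_of -` I1" "circle_of -` I2"
    using assms by (intro matched_lifts_vimage)
  obtain c :: real where c: "c = 1 \<or> c = -1" "\<alpha>2 - c * \<alpha>1 \<in> \<int>"
    and "\<And>x. x \<in> circle_of -` I1 \<longleftrightarrow> c * x \<in> circle_of -` I2"
    by (rule rotation_numbers_eq_or_opposite) blast
  then have mem: "circle_of x \<in> I1 \<longleftrightarrow> circle_of (c * x) \<in> I2" for x
    by (simp only: vimage_eq)
  from c(1) show "(frac \<alpha>1 = frac \<alpha>2 \<and> I1 = I2) \<or> (frac \<alpha>1 = 1 - frac \<alpha>2 \<and> I1 = uminus ` I2)"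
  proof
    assume "c = 1"
    have "frac \<alpha>2 = frac \<alpha>1"
      using c(2) \<open>c = 1\<close> by (simp add: frac_eq_frac_iff)
    moreover have "z \<in> I1 \<longleftrightarrow> z \<in> I2" for z
      using mem \<open>c = 1\<close> by (metis circle_of_cases mult_1)
    ultimately show ?thesis by auto
  next
    assume "c = -1"
    have "frac \<alpha>1 = frac (- \<alpha>2)"
      using c(2) \<open>c = -1\<close> by (simp add: frac_eq_frac_iff add.commute)
    \<comment> \<open>The identity \<open>frac (- x) = 1 - frac x\<close> fails at integers, where
      both fractional parts are 0.\<close>
    moreover have "\<alpha>2 \<notin> \<int>" using assms(2) Ints_subset_Rats by blast
    ultimately have "frac \<alpha>1 = 1 - frac \<alpha>2" by (simp add: frac_neg)
    moreover have "z \<in> I1 \<longleftrightarrow> - z \<in> I2" for z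
      using mem \<open>c = -1\<close> by (metis circle_of_cases mult_minus1 uminus_circle.abs_eq)
    then have "I1 = uminus ` I2" unfolding set_eq_iff image_iff by (metis minus_minus)
    ultimately show ?thesis by blast
  qed
next
  \<comment> \<open>Conversely, the two orbits of 0 agree at every time in the first case and are
    negatives of each other in the second.\<close>
  assume "(frac \<alpha>1 = frac \<alpha>2 \<and> I1 = I2) \<or> (frac \<alpha>1 = 1 - frac \<alpha>2 \<and> I1 = uminus ` I2)"
  then show "itinerary \<alpha>1 I1 = itinerary \<alpha>2 I2"
  proof (elim disjE conjE)
    assume "frac \<alpha>1 = frac \<alpha>2" "I1 = I2"
    then have d: "\<alpha>1 - \<alpha>2 = of_int (\<lfloor>\<alpha>1\<rfloor> - \<lfloor>\<alpha>2\<rfloor>)" by (simp add: frac_def)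
    have "real n * \<alpha>1 - real n * \<alpha>2 \<in> \<int>" for n
      unfolding right_diff_distrib[symmetric] d by (intro Ints_mult) simp_all
    then have "circle_of (real n * \<alpha>1) = circle_of (real n * \<alpha>2)" for n
      by (simp add: circle_of_eq_iff)
    then show ?thesis using \<open>I1 = I2\<close> by (simp add: itinerary_eq_iff)
  next
    assume "frac \<alpha>1 = 1 - frac \<alpha>2" "I1 = uminus ` I2"
    \<comment> \<open>The summand 1 is the sum of the two fractional parts.\<close>
    then have d: "\<alpha>1 + \<alpha>2 = of_int (\<lfloor>\<alpha>1\<rfloor> + \<lfloor>\<alpha>2\<rfloor> + 1)" by (simp add: frac_def)
    have "real n * \<alpha>1 - - (real n * \<alpha>2) \<in> \<int>" for n
      unfolding diff_minus_eq_add distrib_left[symmetric] d by (intro Ints_mult) simp_all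
    then have "circle_of (real n * \<alpha>1) = - circle_of (real n * \<alpha>2)" for n
      by (simp add: circle_of_eq_iff uminus_circle.abs_eq)
    moreover have "- z \<in> I1 \<longleftrightarrow> z \<in> I2" for z
      unfolding \<open>I1 = uminus ` I2\<close> by (rule inj_image_mem_iff) (simp add: inj_def)
    ultimately show ?thesis by (simp add: itinerary_eq_iff)
  qed
qed

end
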